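(* Let $K\subseteq\mathbb{R}^m$ be a nonempty, closed, and convex set, and let $F:K\to\mathbb{R}^m$ be a mapping. Let $\varphi:K\to\mathbb{R}^m$ be a strongly monotone mapping with strong monotonicity constant $\mu_\varphi>0$, and let $\tilde x$ be a solution of VI$(K,\varphi)$. Assume that, for some $d<\mu_\varphi$, $\|\varphi(x)-F(x)\|\le d\|x-\tilde x\|$ for all $x\in K$. Then $\tilde x$ is a Minty solution to VI$(K,F)$.
   Context: For a mapping $G:K\to\mathbb{R}^m$, a solution of VI$(K,G)$ is a point $x^*\in K$ such that $\langle G(x^* ),x-x^*\rangle\ge 0$ for all $x\in K$; a Minty solution of VI$(K,G)$ is a point $x^*\in K$ such that $\langle G(x),x-x^*\rangle\ge 0$ for all $x\in K$. The mapping $\varphi$ is strongly monotone with constant $\mu_\varphi>0$ if $\langle\varphi(x)-\varphi(y),x-y\rangle\ge\mu_\varphi\|x-y\|^2$ for all $x,y\in K$. *)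

theory Defs
  imports "HOL-Analysis.Analysis"
begin

text \<open>
  A mapping \<open>G : K \<rightarrow> \<real>\<^sup>m\<close> is represented by a total function on \<open>real ^ 'm\<close>;
  the definitions below only evaluate it at points of \<open>K\<close>.
\<close>

definition VI_solution ::
  "(real ^ 'm) set \<Rightarrow> (real ^ 'm \<Rightarrow> real ^ 'm) \<Rightarrow> real ^ 'm \<Rightarrow> bool" where
  "VI_solution K G z \<longleftrightarrow> z \<in> K \<and> (\<forall>x\<in>K. G z \<bullet> (x - z) \<ge> 0)"

definition Minty_solution ::
  "(real ^ 'm) set \<Rightarrow> (real ^ 'm \<Rightarrow> real ^ 'm) \<Rightarrow> real ^ 'm \<Rightarrow> bool" where
  "Minty_solution K G z \<longleftrightarrow> z \<in> K \<and> (\<forall>x\<in>K. G x \<bullet> (x - z) \<ge> 0)"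

definition strongly_monotone_on ::
  "(real ^ 'm) set \<Rightarrow> (real ^ 'm \<Rightarrow> real ^ 'm) \<Rightarrow> real \<Rightarrow> bool" where
  "strongly_monotone_on K G \<mu> \<longleftrightarrow>
     \<mu> > 0 \<and> (\<forall>x\<in>K. \<forall>y\<in>K. (G x - G y) \<bullet> (x - y) \<ge> \<mu> * (norm (x - y))\<^sup>2)"

end

theory Submission
  imports Defs
begin

text \<open>Write \<open>F x\<close> as
  \<open>\<phi> xt + (\<phi> x - \<phi> xt) - (\<phi> x - F x)\<close> and pair it with
  \<open>x - xt\<close>. The first term contributes a nonnegative amount because \<open>xt\<close>
  solves the inequality for \<open>\<phi>\<close>, the second at least
  \<open>\<mu> * (norm (x - xt))\<^sup>2\<close> by strong monotonicity. The perturbation removes at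
  most \<open>d * (norm (x - xt))\<^sup>2\<close> by Cauchy-Schwarz, which the monotonicity gain
  absorbs since \<open>d < \<mu>\<close>.\<close>

theorem theorem7:
  fixes K :: "(real ^ 'm) set"
    and F \<phi> :: "real ^ 'm \<Rightarrow> real ^ 'm"
    and \<mu> d :: real
    and xt :: "real ^ 'm"
  assumes "K \<noteq> {}" and "closed K" and "convex K"
    and "strongly_monotone_on K \<phi> \<mu>"
    and "VI_solution K \<phi> xt"
    and "d < \<mu>"
    and "\<forall>x\<in>K. norm (\<phi> x - F x) \<le> d * norm (x - xt)"
  shows "Minty_solution K F xt"
  unfolding Minty_solution_def
proof (intro conjI ballI)
  show "xt \<in> K"
    using assms(5) by (simp add: VI_solution_def)
  fix x assume x: "x \<in> K"
  have "\<mu> * (norm (x - xt))\<^sup>2 \<le> (\<phi> x - \<phi> xt) \<bullet> (x - xt)"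
    using assms(4) x \<open>xt \<in> K\<close> by (simp add: strongly_monotone_on_def)
  moreover have "0 \<le> \<phi> xt \<bullet> (x - xt)"
    using assms(5) x by (simp add: VI_solution_def)
  moreover have "(\<phi> x - F x) \<bullet> (x - xt) \<le> d * (norm (x - xt))\<^sup>2"
  proof -
    have "(\<phi> x - F x) \<bullet> (x - xt) \<le> norm (\<phi> x - F x) * norm (x - xt)"
      by (rule norm_cauchy_schwarz)
    also have "\<dots> \<le> (d * norm (x - xt)) * norm (x - xt)"
      using assms(7) x by (intro mult_right_mono) auto
    finally show ?thesis
      by (simp add: power2_eq_square mult.assoc)
  qed
  moreover have "d * (norm (x - xt))\<^sup>2 \<le> \<mu> * (norm (x - xt))\<^sup>2"
    using assms(6) by (intro mult_right_mono) auto
  \<comment> \<open>Once the inner products are expanded, the terms in \<open>\<phi> x\<close> and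
    \<open>\<phi> xt\<close> cancel, and the four bounds combine linearly.\<close>
  ultimately show "0 \<le> F x \<bullet> (x - xt)"
    by (simp add: inner_diff_left)
qed

end
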